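(* Let $m>1$ be a squarefree integer with at least two prime divisors. For each complementary pair $\{a,b\}\neq\{0,1\}$ of idempotents of the multiplicative semigroup $Z_m(\cdot)$ of residues modulo $m$, represented by integers $0\le a,b<m$, one has $a+b=m+1$ (as natural numbers).
   Context: $Z_m(\cdot)$ is the set of residues modulo $m$ under multiplication. Residues are identified with their principal values, i.e. the representatives in $\{0,1,\dots,m-1\}$, and the sum $a+b$ is the ordinary sum of natural numbers. An idempotent is a residue $e$ with $e^2\equiv e \pmod m$. Idempotents are partially ordered by $e\ge f$ iff $ef\equiv f \pmod m$; with this order the idempotents form a Boolean lattice with top $1$ and bottom $0$, and $\mathrm{lub}(a,b)$ denotes the join (least upper bound). Two idempotents $a,b$ are called complementary iff $ab\equiv 0 \pmod m$ and $\mathrm{lub}(a,b)\equiv 1 \pmod m$. *)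

theory Defs
  imports "HOL-Computational_Algebra.Squarefree" "HOL-Number_Theory.Cong" "HOL-Algebra.Lattice"
begin

text \<open>Residues modulo \<open>m\<close> are identified with their representatives in \<open>{..<m}\<close>.\<close>

definition idempotents :: "nat \<Rightarrow> nat set" where
  "idempotents m = {e \<in> {..<m}. [e\<^sup>2 = e] (mod m)}"

text \<open>The argument order of \<open>le\<close> is reversed with respect to the usual definition
  that \<open>e \<ge> f\<close> iff \<open>ef \<equiv> f\<close> modulo \<open>m\<close>.\<close>

definition idem_order :: "nat \<Rightarrow> nat gorder" where
  "idem_order m =
    \<lparr>carrier = idempotents m, eq = (=), le = (\<lambda>f e. [e * f = f] (mod m))\<rparr>"

definition complementary :: "nat \<Rightarrow> nat \<Rightarrow> nat \<Rightarrow> bool" where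
  "complementary m a b \<longleftrightarrow>
     a \<in> idempotents m \<and> b \<in> idempotents m \<and>
     [a * b = 0] (mod m) \<and> [a \<squnion>\<^bsub>idem_order m\<^esub> b = 1] (mod m)"

end

theory Submission
  imports Defs
begin

text \<open>For orthogonal idempotents \<open>a\<close> and \<open>b\<close> the residue of \<open>a + b\<close> is again idempotent and is
  their join. Complementarity therefore says \<open>a + b \<equiv> 1\<close> modulo \<open>m\<close>, and as \<open>a + b < 2m\<close> the
  only values left are \<open>1\<close>, which forces \<open>{a, b} = {0, 1}\<close>, and \<open>m + 1\<close>.\<close>

lemma idem_le_antisym:
  assumes "x < m" "y < m" "[x * y = y] (mod m)" "[y * x = x] (mod m)"
  shows "x = (y::nat)"
  using assms by (metis cong_def mod_less mult.commute)

text \<open>Orthogonality removes the cross terms, so \<open>a + b\<close> acts as the identity on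
  \<open>a\<close> and on \<open>b\<close>. Any \<open>u\<close> that fixes both fixes their sum by
  distributivity.\<close>

lemma least_Upper_orthogonal:
  assumes a: "a \<in> idempotents m" and b: "b \<in> idempotents m" and ab: "[a * b = 0] (mod m)"
  shows "least (idem_order m) ((a + b) mod m) (Upper (idem_order m) {a, b})"
proof -
  have am: "a < m" "[a * a = a] (mod m)" and bm: "b < m" "[b * b = b] (mod m)"
    using a b by (auto simp: idempotents_def power2_eq_square)
  have up_a: "[(a + b) * a = a] (mod m)"
    using cong_add[OF am(2) ab] by (simp add: algebra_simps)
  have up_b: "[(a + b) * b = b] (mod m)"
    using cong_add[OF ab bm(2)] by (simp add: algebra_simps)
  \<comment> \<open>Idempotence is the sum of the two upper-bound congruences.\<close>
  have "[(a + b) * (a + b) = a + b] (mod m)"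
    using cong_add[OF up_a up_b] by (simp add: algebra_simps)
  hence c: "(a + b) mod m \<in> idempotents m"
    using am by (simp add: idempotents_def cong_def power2_eq_square mod_mult_eq)
  have least: "[u * (a + b) = a + b] (mod m)"
    if "[u * a = a] (mod m)" "[u * b = b] (mod m)" for u
    using cong_add[OF that] by (simp add: algebra_simps)
  show ?thesis
    using a b c up_a up_b least
    by (auto simp: least_def Upper_def idem_order_def cong_def mod_mult_left_eq mod_mult_right_eq)
qed

text \<open>The join is a \<open>SOME\<close> choice of a least upper bound, so exhibiting one does
  not suffice: antisymmetry on representatives below \<open>m\<close> makes it unique.\<close>

lemma join_orthogonal:
  assumes "a \<in> idempotents m" "b \<in> idempotents m" "[a * b = 0] (mod m)"
  shows "a \<squnion>\<^bsub>idem_order m\<^esub> b = (a + b) mod m"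
proof -
  have uniq: "x = y"
    if "least (idem_order m) x (Upper (idem_order m) {a, b})"
      "least (idem_order m) y (Upper (idem_order m) {a, b})" for x y
  proof -
    have mem: "x \<in> Upper (idem_order m) {a, b}" "y \<in> Upper (idem_order m) {a, b}"
      using that by (auto simp: least_def)
    hence "x < m" "y < m"
      by (auto simp: Upper_def idem_order_def idempotents_def)
    moreover have "[y * x = x] (mod m)" "[x * y = y] (mod m)"
      using that mem by (auto simp: least_def idem_order_def)
    ultimately show ?thesis
      using idem_le_antisym by blast
  qed
  show ?thesis
    unfolding join_def sup_def
    using least_Upper_orthogonal[OF assms] uniq by (intro some_equality) auto
qed

theorem lemma2p1:
  fixes m a b :: nat
  assumes "m > 1" and "squarefree m" and "card (prime_factors m) \<ge> 2"
    and "complementary m a b" and "{a, b} \<noteq> {0, 1}"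
  shows "a + b = m + 1"
proof -
  have idem: "a \<in> idempotents m" "b \<in> idempotents m" and "[a * b = 0] (mod m)"
    and "[a \<squnion>\<^bsub>idem_order m\<^esub> b = 1] (mod m)"
    using assms(4) by (auto simp: complementary_def)
  \<comment> \<open>Since \<open>m > 1\<close>, the residue of \<open>1\<close> is \<open>1\<close>
    itself.\<close>
  hence sum: "(a + b) mod m = 1"
    using \<open>m > 1\<close> by (simp add: join_orthogonal cong_def)
  have less: "a < m" "b < m"
    using idem by (auto simp: idempotents_def)
  show ?thesis
  proof (cases "a + b < m")
    case True
    with sum have "a + b = 1" by simp
    hence "a = 0 \<and> b = 1 \<or> a = 1 \<and> b = 0" by arith
    with assms(5) show ?thesis by auto
  next
    case False
    \<comment> \<open>Here \<open>m \<le> a + b < 2 * m\<close>, so reduction subtracts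
      \<open>m\<close> exactly once.\<close>
    with less have "(a + b) mod m = a + b - m"
      by (simp add: mod_if)
    with sum show ?thesis by simp
  qed
qed

end
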